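(* For the simple directed cycle graph $C_n$, $n\geq 2$, $$\sigma(S_{C_n})=2\,\mathcal{R}e\big(\sigma(\Delta_{C_n})\big)=\{2\,\mathcal{R}e(\lambda):\lambda\in\sigma(\Delta_{C_n})\}.$$
   Context: $C_n$ is the directed graph with vertex set $\{0,1,\dots,n-1\}$ and directed edges $(0,1),(1,2),\dots,(n-2,n-1),(n-1,0)$, with all edge weights $b$ and vertex weights $m$ equal to $1$ (indices mod $n$). On functions $f:\{0,\dots,n-1\}\to\mathbb C$, with inner product $\sum_k f(k)\overline{g(k)}$, $\Delta_{C_n}f(k)=f(k)-f(k+1)$, and $S_{C_n}=\Delta_{C_n}+\Delta_{C_n}^*$, where $^*$ is the adjoint. $\sigma(\cdot)$ denotes the spectrum (set of eigenvalues). *)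

theory Defs
  imports Complex_Main "HOL-Library.FuncSet" "Graph_Theory.Pair_Digraph"
begin

record 'a weighted_digraph = "'a pair_pre_digraph" +
  edge_weight :: "'a \<times> 'a \<Rightarrow> real"
  vertex_weight :: "'a \<Rightarrow> real"

text \<open>
  A complex function on the vertex set \<open>V\<close> is an element of \<open>extensional V\<close>
  (so that equality of such functions is equality on \<open>V\<close>), and an operator is a map
  between such functions.
\<close>

definition graph_inner :: "('a, 'b) weighted_digraph_scheme \<Rightarrow> ('a \<Rightarrow> complex) \<Rightarrow> ('a \<Rightarrow> complex) \<Rightarrow> complex"
  where "graph_inner G f g =
    (\<Sum>x\<in>pverts G. complex_of_real (vertex_weight G x) * f x * cnj (g x))"

definition graph_laplacian :: "('a, 'b) weighted_digraph_scheme \<Rightarrow> ('a \<Rightarrow> complex) \<Rightarrow> ('a \<Rightarrow> complex)"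
  where "graph_laplacian G f = (\<lambda>x\<in>pverts G.
    (1 / complex_of_real (vertex_weight G x)) *
      (\<Sum>y | (x, y) \<in> parcs G. complex_of_real (edge_weight G (x, y)) * (f x - f y)))"

text \<open>
  The description is uniquely satisfied for linear operators on a finite graph with positive
  vertex weights; \<open>graph_adjoint_laplacian_dicycle\<close> below checks the case of interest.
\<close>

definition graph_adjoint ::
  "('a, 'b) weighted_digraph_scheme \<Rightarrow> (('a \<Rightarrow> complex) \<Rightarrow> ('a \<Rightarrow> complex)) \<Rightarrow> ('a \<Rightarrow> complex) \<Rightarrow> ('a \<Rightarrow> complex)"
  where "graph_adjoint G T g = (THE h. h \<in> extensional (pverts G) \<and>
    (\<forall>f\<in>extensional (pverts G). graph_inner G (T f) g = graph_inner G f h))"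

definition graph_symmetric_laplacian ::
  "('a, 'b) weighted_digraph_scheme \<Rightarrow> ('a \<Rightarrow> complex) \<Rightarrow> ('a \<Rightarrow> complex)"
  where "graph_symmetric_laplacian G f = (\<lambda>x\<in>pverts G.
    graph_laplacian G f x + graph_adjoint G (graph_laplacian G) f x)"

definition graph_spectrum ::
  "('a, 'b) weighted_digraph_scheme \<Rightarrow> (('a \<Rightarrow> complex) \<Rightarrow> ('a \<Rightarrow> complex)) \<Rightarrow> complex set"
  where "graph_spectrum G T = {\<mu>. \<exists>f\<in>extensional (pverts G).
    (\<exists>x\<in>pverts G. f x \<noteq> 0) \<and> T f = (\<lambda>x\<in>pverts G. \<mu> * f x)}"

definition dicycle :: "nat \<Rightarrow> nat weighted_digraph"
  where "dicycle n = \<lparr> pverts = {0..<n}, parcs = {(k, (k + 1) mod n) |k. k < n},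
    edge_weight = (\<lambda>_. 1), vertex_weight = (\<lambda>_. 1) \<rparr>"

lemma graph_inner_dicycle:
  "graph_inner (dicycle n) f g = (\<Sum>k<n. f k * cnj (g k))"
  by (simp add: graph_inner_def dicycle_def atLeast0LessThan)

lemma graph_laplacian_dicycle:
  "graph_laplacian (dicycle n) f = (\<lambda>k\<in>{0..<n}. f k - f ((k + 1) mod n))"
proof -
  have "{y. (k, y) \<in> parcs (dicycle n)} = {(k + 1) mod n}" if "k < n" for k
    using that by (auto simp: dicycle_def)
  then show ?thesis
    by (auto simp: graph_laplacian_def dicycle_def fun_eq_iff restrict_def)
qed

lemma sum_Suc_mod:
  fixes n :: nat and F :: "nat \<Rightarrow> complex"
  shows "(\<Sum>k<n. F ((k + 1) mod n)) = (\<Sum>k<n. F k)"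
proof (cases n)
  case (Suc m)
  have "(\<Sum>k<Suc m. F ((k + 1) mod Suc m)) = (\<Sum>k<m. F (Suc k)) + F 0"
    by simp
  also have "\<dots> = (\<Sum>k<Suc m. F k)"
    by (subst sum.lessThan_Suc_shift) simp
  finally show ?thesis using Suc by simp
qed simp

lemma graph_adjoint_laplacian_dicycle:
  fixes n :: nat and g :: "nat \<Rightarrow> complex"
  defines "A \<equiv> graph_adjoint (dicycle n) (graph_laplacian (dicycle n)) g"
  shows "A \<in> extensional {0..<n}"
    and "graph_inner (dicycle n) (graph_laplacian (dicycle n) f) g = graph_inner (dicycle n) f A"
    and "A = (\<lambda>k\<in>{0..<n}. g k - g ((k + n - 1) mod n))"
proof -
  let ?h = "\<lambda>k\<in>{0..<n}. g k - g ((k + n - 1) mod n)"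
  have pv: "pverts (dicycle n) = {0..<n}" by (simp add: dicycle_def)
  have adj: "graph_inner (dicycle n) (graph_laplacian (dicycle n) f) g
      = graph_inner (dicycle n) f ?h" for f
  proof -
    have pred_suc: "((k + 1) mod n + n - 1) mod n = k" if "k < n" for k
      using that by (cases "k + 1 = n") auto
    have "(\<Sum>k<n. f k * cnj (g ((k + n - 1) mod n)))
        = (\<Sum>k<n. f ((k + 1) mod n) * cnj (g (((k + 1) mod n + n - 1) mod n)))"
      by (rule sum_Suc_mod[symmetric])
    also have "\<dots> = (\<Sum>k<n. f ((k + 1) mod n) * cnj (g k))"
      by (intro sum.cong refl) (simp only: pred_suc lessThan_iff)
    finally show ?thesis
      by (simp add: graph_inner_dicycle graph_laplacian_dicycle algebra_simps sum_subtractf)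
  qed
  have A: "A = ?h"
    unfolding A_def graph_adjoint_def pv
  proof (rule the_equality, safe)
    fix f show "graph_inner (dicycle n) (graph_laplacian (dicycle n) f) g
      = graph_inner (dicycle n) f ?h" by (rule adj)
  next
    fix h assume h: "h \<in> extensional {0..<n}"
      and eq: "\<forall>f\<in>extensional {0..<n}.
        graph_inner (dicycle n) (graph_laplacian (dicycle n) f) g = graph_inner (dicycle n) f h"
    show "h = ?h"
    proof (rule extensionalityI[OF h])
      fix k assume k: "k \<in> {0..<n}"
      let ?d = "\<lambda>j\<in>{0..<n}. if j = k then 1 else (0::complex)"
      have pick: "graph_inner (dicycle n) ?d u = cnj (u k)" for u
      proof -
        have "graph_inner (dicycle n) ?d u = (\<Sum>j<n. if j = k then cnj (u j) else 0)"
          unfolding graph_inner_dicycle by (intro sum.cong) auto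
        then show ?thesis using k by simp
      qed
      have "graph_inner (dicycle n) ?d h = graph_inner (dicycle n) ?d ?h"
        using eq adj[of ?d] by simp
      then show "h k = ?h k" unfolding pick by (simp only: complex_cnj_cancel_iff)
    qed simp
  qed simp
  show "A = ?h" by (rule A)
  show "A \<in> extensional {0..<n}" unfolding A by simp
  show "graph_inner (dicycle n) (graph_laplacian (dicycle n) f) g = graph_inner (dicycle n) f A"
    unfolding A by (rule adj)
qed

end

(* Write w = 1 - lambda and let T be the cyclic shift, so that the Laplacian is 1 - T and
   T is unitary. If T f = w f, then |w| = 1 and S f = (2 - w - cnj w) f. Conversely, an
   eigenvector f of S = 2 - T - inverse T for mu satisfies (T - w) (T - w') f = 0, where
   w + w' = 2 - mu and w w' = 1. Hence w or w' is an eigenvalue of T, so it has modulus 1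
   and the other one is its conjugate. *)
theory Submission
  imports Defs
begin

lemma pverts_dicycle: "pverts (dicycle n) = {0..<n}"
  by (simp add: dicycle_def)

lemma mem_graph_spectrum_dicycle_iff:
  "\<mu> \<in> graph_spectrum (dicycle n) T \<longleftrightarrow>
    (\<exists>f\<in>extensional {0..<n}. (\<exists>k<n. f k \<noteq> 0) \<and> T f = (\<lambda>k\<in>{0..<n}. \<mu> * f k))"
  by (simp add: graph_spectrum_def pverts_dicycle Bex_def)

lemma dicycle_laplacian_eigenvalue_iff:
  "\<mu> \<in> graph_spectrum (dicycle n) (graph_laplacian (dicycle n)) \<longleftrightarrow>
    (\<exists>f. (\<exists>k<n. f k \<noteq> 0) \<and> (\<forall>k<n. f ((k + 1) mod n) = (1 - \<mu>) * f k))"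
    (is "_ \<longleftrightarrow> ?R")
proof
  assume "\<mu> \<in> graph_spectrum (dicycle n) (graph_laplacian (dicycle n))"
  then obtain f where nz: "\<exists>k<n. f k \<noteq> 0"
    and eq: "(\<lambda>k\<in>{0..<n}. f k - f ((k + 1) mod n)) = (\<lambda>k\<in>{0..<n}. \<mu> * f k)"
    unfolding mem_graph_spectrum_dicycle_iff graph_laplacian_dicycle by blast
  have "f ((k + 1) mod n) = (1 - \<mu>) * f k" if "k < n" for k
    using fun_cong[OF eq, of k] that by (simp add: algebra_simps)
  with nz show ?R by blast
next
  assume ?R
  then obtain f where nz: "\<exists>k<n. f k \<noteq> 0"
    and eq: "\<And>k. k < n \<Longrightarrow> f ((k + 1) mod n) = (1 - \<mu>) * f k"
    by blast
  define g where "g = restrict f {0..<n}"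
  have g: "g k = f k" if "k < n" for k using that by (simp add: g_def)
  have "graph_laplacian (dicycle n) g = (\<lambda>k\<in>{0..<n}. \<mu> * g k)"
    unfolding graph_laplacian_dicycle
  proof (rule restrict_ext)
    fix k assume "k \<in> {0..<n}"
    then have "k < n" "(k + 1) mod n < n" by auto
    then show "g k - g ((k + 1) mod n) = \<mu> * g k"
      by (simp only: g eq) (simp add: algebra_simps)
  qed
  moreover have "g \<in> extensional {0..<n}" by (simp add: g_def)
  ultimately show "\<mu> \<in> graph_spectrum (dicycle n) (graph_laplacian (dicycle n))"
    unfolding mem_graph_spectrum_dicycle_iff using nz g by metis
qed

lemma graph_symmetric_laplacian_dicycle:
  "graph_symmetric_laplacian (dicycle n) f =
    (\<lambda>k\<in>{0..<n}. 2 * f k - f ((k + 1) mod n) - f ((k + n - 1) mod n))"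
  by (auto simp: graph_symmetric_laplacian_def graph_laplacian_dicycle
      graph_adjoint_laplacian_dicycle(3) pverts_dicycle fun_eq_iff)

lemma pred_Suc_mod: "((k + 1) mod n + n - 1) mod n = k" if "k < n" for k n :: nat
  using that by (cases "k + 1 = n") auto

lemma Suc_pred_mod: "((k + n - 1) mod n + 1) mod n = k" if "k < n" for k n :: nat
  using that by (cases k) auto

text \<open>The eigenvalue equation is read at the successor of \<open>k\<close> instead of at
  \<open>k\<close>. The cyclic successor permutes the vertices, so nothing is lost, and the result
  is a recurrence in forward shifts alone, which can be factored as a quadratic in the
  shift.\<close>

lemma dicycle_symmetric_laplacian_eigenvalue_iff:
  "\<mu> \<in> graph_spectrum (dicycle n) (graph_symmetric_laplacian (dicycle n)) \<longleftrightarrow>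
    (\<exists>f. (\<exists>k<n. f k \<noteq> 0) \<and>
      (\<forall>k<n. f (((k + 1) mod n + 1) mod n) = (2 - \<mu>) * f ((k + 1) mod n) - f k))"
    (is "_ \<longleftrightarrow> ?R")
proof
  assume "\<mu> \<in> graph_spectrum (dicycle n) (graph_symmetric_laplacian (dicycle n))"
  then obtain f where nz: "\<exists>k<n. f k \<noteq> 0"
    and eq: "(\<lambda>k\<in>{0..<n}. 2 * f k - f ((k + 1) mod n) - f ((k + n - 1) mod n))
      = (\<lambda>k\<in>{0..<n}. \<mu> * f k)"
    unfolding mem_graph_spectrum_dicycle_iff graph_symmetric_laplacian_dicycle by blast
  have "f (((k + 1) mod n + 1) mod n) = (2 - \<mu>) * f ((k + 1) mod n) - f k" if k: "k < n" for k
  proof -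
    have "(k + 1) mod n \<in> {0..<n}" using k by simp
    with fun_cong[OF eq, of "(k + 1) mod n"]
    have "2 * f ((k + 1) mod n) - f (((k + 1) mod n + 1) mod n) - f k = \<mu> * f ((k + 1) mod n)"
      by (simp only: restrict_apply' pred_Suc_mod[OF k])
    then show ?thesis by (simp add: algebra_simps)
  qed
  with nz show ?R by blast
next
  assume ?R
  then obtain f where nz: "\<exists>k<n. f k \<noteq> 0"
    and eq: "\<And>k. k < n \<Longrightarrow>
      f (((k + 1) mod n + 1) mod n) = (2 - \<mu>) * f ((k + 1) mod n) - f k"
    by blast
  define g where "g = restrict f {0..<n}"
  have g: "g k = f k" if "k < n" for k using that by (simp add: g_def)
  have "graph_symmetric_laplacian (dicycle n) g = (\<lambda>k\<in>{0..<n}. \<mu> * g k)"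
    unfolding graph_symmetric_laplacian_dicycle
  proof (rule restrict_ext)
    fix k assume "k \<in> {0..<n}"
    then have k: "k < n" and s: "(k + 1) mod n < n" and p: "(k + n - 1) mod n < n" by auto
    \<comment> \<open>This is the recurrence at the predecessor of \<open>k\<close>, whose two
      successors are \<open>k\<close> and \<open>(k + 1) mod n\<close>.\<close>
    have "f ((k + 1) mod n) = (2 - \<mu>) * f k - f ((k + n - 1) mod n)"
      using eq[OF p] by (simp only: Suc_pred_mod[OF k])
    then show "2 * g k - g ((k + 1) mod n) - g ((k + n - 1) mod n) = \<mu> * g k"
      by (simp only: g[OF k] g[OF s] g[OF p]) (simp add: algebra_simps)
  qed
  moreover have "g \<in> extensional {0..<n}" by (simp add: g_def)
  ultimately show "\<mu> \<in> graph_spectrum (dicycle n) (graph_symmetric_laplacian (dicycle n))"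
    unfolding mem_graph_spectrum_dicycle_iff using nz g by metis
qed

text \<open>The shift only permutes the values of \<open>f\<close>, so it preserves the squared norm
  \<open>?N\<close>, while the eigenvalue equation scales it by \<open>w * cnj w\<close>.\<close>

lemma cyclic_shift_eigenvalue_unimodular:
  fixes f :: "nat \<Rightarrow> complex"
  assumes nz: "\<exists>k<n. f k \<noteq> 0" and eq: "\<And>k. k < n \<Longrightarrow> f ((k + 1) mod n) = w * f k"
  shows "w * cnj w = 1"
proof -
  let ?N = "\<Sum>k<n. f k * cnj (f k)"
  have "w * cnj w * ?N = (\<Sum>k<n. f ((k + 1) mod n) * cnj (f ((k + 1) mod n)))"
    unfolding sum_distrib_left by (intro sum.cong refl) (simp add: eq[simplified])
  also have "\<dots> = ?N" by (rule sum_Suc_mod)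
  finally have "w * cnj w * ?N = ?N" .
  moreover have "?N \<noteq> 0"
  proof -
    \<comment> \<open>Over the reals the summands are nonnegative, so the sum can vanish only if
      every term does.\<close>
    have "?N = complex_of_real (\<Sum>k<n. (cmod (f k))\<^sup>2)"
      by (simp only: of_real_sum complex_norm_square)
    moreover have "(\<Sum>k<n. (cmod (f k))\<^sup>2) \<noteq> 0"
      using nz by (subst sum_nonneg_eq_0_iff) auto
    ultimately show ?thesis by (simp only: of_real_eq_0_iff not_False_eq_True)
  qed
  ultimately show ?thesis by simp
qed

text \<open>By the quadratic formula, \<open>u\<close> and \<open>v\<close> are the roots of z^2 - c
  z + d.\<close>

lemma complex_two_roots_exist:
  fixes c d :: complex
  obtains u v where "u + v = c" "u * v = d"
proof
  let ?r = "csqrt (c\<^sup>2 - 4 * d)"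
  show "(c + ?r) / 2 + (c - ?r) / 2 = c" by (simp add: field_simps)
  have "(c + ?r) / 2 * ((c - ?r) / 2) = (c\<^sup>2 - ?r\<^sup>2) / 4"
    by (simp add: power2_eq_square algebra_simps)
  then show "(c + ?r) / 2 * ((c - ?r) / 2) = d" by simp
qed

lemma complex_of_real_two_Re_one_minus:
  "complex_of_real (2 * Re (1 - w)) = 2 - (w + cnj w)"
  by (simp add: complex_eq_iff)

theorem corollary2p1:
  fixes n :: nat
  assumes "n \<ge> 2"
  shows "graph_spectrum (dicycle n) (graph_symmetric_laplacian (dicycle n)) =
    {complex_of_real (2 * Re \<mu>) |\<mu>.
      \<mu> \<in> graph_spectrum (dicycle n) (graph_laplacian (dicycle n))}"
proof (intro equalityI subsetI)
  fix \<nu> assume "\<nu> \<in> graph_spectrum (dicycle n) (graph_symmetric_laplacian (dicycle n))"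
  then obtain f where nz: "\<exists>k<n. f k \<noteq> 0"
    and eq: "\<And>k. k < n \<Longrightarrow>
      f (((k + 1) mod n + 1) mod n) = (2 - \<nu>) * f ((k + 1) mod n) - f k"
    unfolding dicycle_symmetric_laplacian_eigenvalue_iff by blast
  obtain u v where uv: "u + v = 2 - \<nu>" "u * v = 1"
    by (rule complex_two_roots_exist)
  \<comment> \<open>Applying the factor T - v to \<open>f\<close> leaves a function that the other
    factor, T - u, annihilates.\<close>
  define g where "g k = f ((k + 1) mod n) - v * f k" for k
  have "g ((k + 1) mod n) = u * g k" if "k < n" for k
    unfolding g_def eq[OF that] uv(1)[symmetric] using uv(2) by (simp add: algebra_simps)
  moreover have "f ((k + 1) mod n) = v * f k" if "g k = 0" for k
    using that by (simp add: g_def)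
  \<comment> \<open>If \<open>g\<close> is nonzero at some vertex, take \<open>h = g\<close> and
    \<open>w = u\<close>. Otherwise \<open>f\<close> itself is an eigenfunction of the shift, with
    \<open>w = v\<close>.\<close>
  ultimately obtain w h where nz': "\<exists>k<n. h k \<noteq> 0"
    and eq': "\<And>k. k < n \<Longrightarrow> h ((k + 1) mod n) = w * h k" and w: "w = u \<or> w = v"
    using nz by metis
  have "w * cnj w = 1" using nz' eq' by (rule cyclic_shift_eigenvalue_unimodular)
  then have "w + cnj w = 2 - \<nu>"
    \<comment> \<open>Both \<open>cnj w\<close> and the other root give 1 when multiplied by
      \<open>w\<close>; cancelling \<open>w\<close> identifies them.\<close>
    using w uv by (metis add.commute mult.commute mult_cancel_left mult_zero_left zero_neq_one)
  then have "\<nu> = complex_of_real (2 * Re (1 - w))"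
    unfolding complex_of_real_two_Re_one_minus by simp
  moreover have "1 - w \<in> graph_spectrum (dicycle n) (graph_laplacian (dicycle n))"
    unfolding dicycle_laplacian_eigenvalue_iff using nz' eq' by auto
  ultimately show "\<nu> \<in> {complex_of_real (2 * Re \<mu>) |\<mu>.
      \<mu> \<in> graph_spectrum (dicycle n) (graph_laplacian (dicycle n))}"
    by blast
next
  fix \<nu> assume "\<nu> \<in> {complex_of_real (2 * Re \<mu>) |\<mu>.
      \<mu> \<in> graph_spectrum (dicycle n) (graph_laplacian (dicycle n))}"
  then obtain \<mu> f where \<nu>: "\<nu> = complex_of_real (2 * Re \<mu>)" and nz: "\<exists>k<n. f k \<noteq> 0"
    and eq: "\<And>k. k < n \<Longrightarrow> f ((k + 1) mod n) = (1 - \<mu>) * f k"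
    unfolding dicycle_laplacian_eigenvalue_iff by blast
  define w where "w = 1 - \<mu>"
  have unimodular: "w * cnj w = 1"
    unfolding w_def using nz eq by (rule cyclic_shift_eigenvalue_unimodular)
  have sum: "2 - \<nu> = w + cnj w"
    using complex_of_real_two_Re_one_minus[of w] by (simp add: \<nu> w_def)
  have "f (((k + 1) mod n + 1) mod n) = (2 - \<nu>) * f ((k + 1) mod n) - f k" if k: "k < n" for k
  proof -
    have "(k + 1) mod n < n" using k by simp
    then have "f (((k + 1) mod n + 1) mod n) = w * (w * f k)"
      by (simp only: eq k w_def)
    \<comment> \<open>Expresses w^2 through the sum and product of \<open>w\<close> and
      \<open>cnj w\<close>, which are \<open>2 - \<nu>\<close> and 1; the same \<open>f\<close> thus
      satisfies the recurrence.\<close>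
    also have "\<dots> = (w + cnj w) * (w * f k) - (w * cnj w) * f k"
      by (simp add: algebra_simps)
    finally show ?thesis
      unfolding sum unimodular eq[OF k, folded w_def] by simp
  qed
  with nz show "\<nu> \<in> graph_spectrum (dicycle n) (graph_symmetric_laplacian (dicycle n))"
    unfolding dicycle_symmetric_laplacian_eigenvalue_iff by blast
qed

end
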